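(* Let $(X,T)$ be a dynamical system with the shadowing property. Then the collection of points $x\in X$ whose orbit closure $\overline{\{T^nx\colon n\ge 0\}}$ (with the restriction of $T$) is an odometer is dense in the non-wandering set $\Omega(X,T)$.
   Context: A dynamical system $(X,T)$ is a compact metric space $(X,d)$ with a continuous map $T\colon X\to X$ (not necessarily invertible). A sequence $(x_n)_{n=0}^\infty$ in $X$ is a $\delta$-pseudo-orbit if $d(T(x_n),x_{n+1})<\delta$ for all $n\ge 0$; it is $\varepsilon$-traced by $y\in X$ if $d(T^n(y),x_n)<\varepsilon$ for all $n\ge 0$. $(X,T)$ has the shadowing property if for every $\varepsilon>0$ there is $\delta>0$ such that every $\delta$-pseudo-orbit is $\varepsilon$-traced by some point of $X$. A point $x$ is non-wandering if for every neighborhood $U$ of $x$ there exist $k\ge1$ and $y\in U$ with $T^k(y)\in U$; $\Omega(X,T)$ is the set of non-wandering points. A point $x$ is regularly recurrent if for every open neighborhood $U$ of $x$ there is $k\ge 1$ with $T^{kn}(x)\in U$ for all $n\ge 0$. A system is equicontinuous if for every $\varepsilon>0$ there is $\delta>0$ such that $d(x,y)<\delta$ implies $d(T^n(x),T^n(y))<\varepsilon$ for all $n\ge 0$. An odometer is an equicontinuous system containing a regularly recurrent point with dense (forward) orbit; in particular a periodic orbit is an odometer. *)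

theory Defs
  imports "HOL-Analysis.Analysis"
begin

(* A system is a carrier set X in an ambient metric space together with a map T that is only
   relevant on X.  The restriction of T to a subsystem Y is thus the pair (Y, T).  All
   neighbourhoods are taken in the subspace topology of the carrier. *)

definition dynamical_system :: "'a::metric_space set \<Rightarrow> ('a \<Rightarrow> 'a) \<Rightarrow> bool" where
  "dynamical_system X T \<longleftrightarrow> compact X \<and> T \<in> X \<rightarrow> X \<and> continuous_on X T"

definition pseudo_orbit ::
    "'a::metric_space set \<Rightarrow> ('a \<Rightarrow> 'a) \<Rightarrow> real \<Rightarrow> (nat \<Rightarrow> 'a) \<Rightarrow> bool" where
  "pseudo_orbit X T \<delta> x \<longleftrightarrow> (\<forall>n. x n \<in> X) \<and> (\<forall>n. dist (T (x n)) (x (Suc n)) < \<delta>)"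

definition traced_by ::
    "('a::metric_space \<Rightarrow> 'a) \<Rightarrow> real \<Rightarrow> (nat \<Rightarrow> 'a) \<Rightarrow> 'a \<Rightarrow> bool" where
  "traced_by T \<epsilon> x y \<longleftrightarrow> (\<forall>n. dist ((T ^^ n) y) (x n) < \<epsilon>)"

definition shadowing_property :: "'a::metric_space set \<Rightarrow> ('a \<Rightarrow> 'a) \<Rightarrow> bool" where
  "shadowing_property X T \<longleftrightarrow>
    (\<forall>\<epsilon>>0. \<exists>\<delta>>0. \<forall>x. pseudo_orbit X T \<delta> x \<longrightarrow> (\<exists>y\<in>X. traced_by T \<epsilon> x y))"

definition nonwandering_set :: "'a::metric_space set \<Rightarrow> ('a \<Rightarrow> 'a) \<Rightarrow> 'a set" where
  "nonwandering_set X T =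
    {x \<in> X. \<forall>U\<subseteq>X. x \<in> (top_of_set X) interior_of U \<longrightarrow>
              (\<exists>k\<ge>1. \<exists>y\<in>U. (T ^^ k) y \<in> U)}"

definition regularly_recurrent ::
    "'a::metric_space set \<Rightarrow> ('a \<Rightarrow> 'a) \<Rightarrow> 'a \<Rightarrow> bool" where
  "regularly_recurrent X T x \<longleftrightarrow> x \<in> X \<and>
    (\<forall>U. openin (top_of_set X) U \<and> x \<in> U \<longrightarrow> (\<exists>k\<ge>1. \<forall>n. (T ^^ (k * n)) x \<in> U))"

definition equicontinuous_system :: "'a::metric_space set \<Rightarrow> ('a \<Rightarrow> 'a) \<Rightarrow> bool" where
  "equicontinuous_system X T \<longleftrightarrow> dynamical_system X T \<and>
    (\<forall>\<epsilon>>0. \<exists>\<delta>>0. \<forall>x\<in>X. \<forall>y\<in>X.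
       dist x y < \<delta> \<longrightarrow> (\<forall>n. dist ((T ^^ n) x) ((T ^^ n) y) < \<epsilon>))"

definition forward_orbit :: "('a \<Rightarrow> 'a) \<Rightarrow> 'a \<Rightarrow> 'a set" where
  "forward_orbit T x = range (\<lambda>n. (T ^^ n) x)"

definition odometer :: "'a::metric_space set \<Rightarrow> ('a \<Rightarrow> 'a) \<Rightarrow> bool" where
  "odometer X T \<longleftrightarrow> equicontinuous_system X T \<and>
    (\<exists>x. regularly_recurrent X T x \<and> X \<subseteq> closure (forward_orbit T x))"

(* Points of X have their orbits in X, which is closed for a dynamical system, so the closure
   in the ambient space is the closure in X. *)
definition odometer_points :: "'a::metric_space set \<Rightarrow> ('a \<Rightarrow> 'a) \<Rightarrow> 'a set" where
  "odometer_points X T = {x \<in> X. odometer (closure (forward_orbit T x)) T}"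

end

theory Submission
  imports Defs
begin

text \<open>
  A point \<open>y\<close> is an odometer point as soon as for every \<open>e > 0\<close> there is a period \<open>k \<ge> 1\<close> with
  \<open>dist (T\<^sup>a y) (T\<^sup>a\<^sup>+\<^sup>k\<^sup>i y) \<le> e\<close> for all \<open>a\<close> and \<open>i\<close>: iterates of nearby points of the orbit
  closure then only have to be compared up to time \<open>k\<close>, where uniform continuity applies.

  Such a point is obtained near a given non-wandering point from a sequence of periodic
  pseudo-orbits.  Non-wandering gives the first one.  If \<open>w\<close> traces a pseudo-orbit \<open>p\<close> of period
  \<open>k\<close>, two points of the sequence \<open>T\<^sup>k\<^sup>i w\<close> are close by compactness, so the orbit segment between
  them closes up to a finer pseudo-orbit which stays close to \<open>p\<close> and whose period is a multiple
  of \<open>k\<close>; it is traced by shadowing.  The sets of points tracing the successive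
  pseudo-orbits are nonempty, compact and decreasing, and any common point has the required
  property.
\<close>

section \<open>Iterates and orbit closures\<close>

lemma funpow_in_system:
  assumes "dynamical_system X T" "x \<in> X"
  shows "(T ^^ n) x \<in> X"
  using assms by (induction n) (auto simp: dynamical_system_def)

lemma continuous_on_funpow_system:
  assumes "dynamical_system X T"
  shows "continuous_on X (T ^^ n)"
proof (induction n)
  case (Suc n)
  have "continuous_on X T" and "(T ^^ n) ` X \<subseteq> X"
    using assms funpow_in_system[OF assms] by (auto simp: dynamical_system_def)
  then show ?case
    using continuous_on_compose[OF Suc, of T] continuous_on_subset[of X T] by (simp add: comp_def)
qed (simp add: continuous_on_id)

lemma periodic_add_mult_mod:
  fixes p :: "nat \<Rightarrow> 'a"
  assumes "\<And>a. p (a + k) = p a"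
  shows "p (a + k * i) = p a" and "p (a mod k) = p a"
proof -
  have *: "p (a + k * i) = p a" for a i
  proof (induction i)
    case (Suc i)
    then show ?case using assms[of "a + k * i"] by (simp add: algebra_simps)
  qed simp
  show "p (a + k * i) = p a" by (rule *)
  show "p (a mod k) = p a" using *[of "a mod k" "a div k"] by simp
qed

lemma forward_orbit_subset_system:
  assumes "dynamical_system X T" "y \<in> X"
  shows "closure (forward_orbit T y) \<subseteq> X"
proof (rule closure_minimal)
  show "forward_orbit T y \<subseteq> X"
    using funpow_in_system[OF assms] by (auto simp: forward_orbit_def)
  show "closed X"
    using assms compact_imp_closed by (auto simp: dynamical_system_def)
qed

lemma dynamical_system_orbit_closure:
  assumes "dynamical_system X T" "y \<in> X"
  shows "dynamical_system (closure (forward_orbit T y)) T"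
proof -
  let ?O = "closure (forward_orbit T y)"
  have sub: "?O \<subseteq> X" by (rule forward_orbit_subset_system[OF assms])
  have cont: "continuous_on ?O T"
    using assms sub continuous_on_subset by (auto simp: dynamical_system_def)
  have "compact ?O"
    using assms sub by (metis closed_Int_compact closed_closure dynamical_system_def inf.absorb1)
  moreover have "T ` ?O \<subseteq> ?O"
  proof (rule image_closure_subset[OF cont])
    show "T ` forward_orbit T y \<subseteq> ?O"
    proof (clarsimp simp: forward_orbit_def)
      fix n
      have "T ((T ^^ n) y) = (T ^^ Suc n) y" by simp
      then show "T ((T ^^ n) y) \<in> closure (range (\<lambda>n. (T ^^ n) y))"
        using closure_subset by (metis rangeI subsetD)
    qed
  qed simp
  ultimately show ?thesis
    using cont by (auto simp: dynamical_system_def)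
qed

section \<open>Odometer points: a sufficient condition, and non-wandering\<close>

lemma funpow_uniformly_continuous_below:
  fixes Y :: "'a::metric_space set"
  assumes "dynamical_system Y T" "e > 0"
  shows "\<exists>d>0. \<forall>r<k. \<forall>u\<in>Y. \<forall>v\<in>Y. dist u v < d \<longrightarrow> dist ((T ^^ r) u) ((T ^^ r) v) < e"
proof (induction k)
  case 0
  then show ?case by (auto intro: exI[of _ 1])
next
  case (Suc k)
  then obtain d where d: "d > 0"
    "\<And>r u v. r < k \<Longrightarrow> u \<in> Y \<Longrightarrow> v \<in> Y \<Longrightarrow> dist u v < d \<Longrightarrow> dist ((T ^^ r) u) ((T ^^ r) v) < e"
    by blast
  have "uniformly_continuous_on Y (T ^^ k)"
    using assms(1) continuous_on_funpow_system[OF assms(1)]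
    by (intro compact_uniformly_continuous) (auto simp: dynamical_system_def)
  then obtain d' where d': "d' > 0"
    "\<And>u v. u \<in> Y \<Longrightarrow> v \<in> Y \<Longrightarrow> dist u v < d' \<Longrightarrow> dist ((T ^^ k) u) ((T ^^ k) v) < e"
    using \<open>e > 0\<close> unfolding uniformly_continuous_on_def by meson
  have "dist ((T ^^ r) u) ((T ^^ r) v) < e"
    if "r < Suc k" "u \<in> Y" "v \<in> Y" "dist u v < min d d'" for r u v
    using that d(2)[of r u v] d'(2)[of u v] by (cases "r = k") auto
  then show ?case
    using d(1) d'(1) by (intro exI[of _ "min d d'"]) auto
qed

text \<open>For fixed \<open>k\<close> and \<open>i\<close> the bound is a closed condition on the
  point, so it passes from the orbit of \<open>y\<close> to the whole closure \<open>Y\<close>, with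
  the same \<open>k\<close> for all points. Equicontinuity follows by comparing time
  \<open>n\<close> with \<open>n mod k\<close>, and regular recurrence is the bound at
  \<open>y\<close> itself.\<close>

lemma odometer_pointI:
  assumes dyn: "dynamical_system X T" and y: "y \<in> X"
    and per: "\<And>e. e > 0 \<Longrightarrow> \<exists>k\<ge>1. \<forall>a i. dist ((T ^^ a) y) ((T ^^ (a + k * i)) y) \<le> e"
  shows "y \<in> odometer_points X T"
proof -
  define Y where "Y = closure (forward_orbit T y)"
  have dynY: "dynamical_system Y T"
    unfolding Y_def by (rule dynamical_system_orbit_closure[OF dyn y])
  have "(T ^^ 0) y \<in> forward_orbit T y"
    unfolding forward_orbit_def by (rule rangeI)
  then have yY: "y \<in> Y"
    using closure_subset unfolding Y_def by auto
  have perY: "\<exists>k\<ge>1. \<forall>z\<in>Y. \<forall>i. dist z ((T ^^ (k * i)) z) \<le> e" if e: "e > 0" for e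
  proof -
    obtain k where k: "k \<ge> 1" "\<And>a i. dist ((T ^^ a) y) ((T ^^ (a + k * i)) y) \<le> e"
      using per[OF e] by blast
    have "dist z ((T ^^ (k * i)) z) \<le> e" if z: "z \<in> Y" for z i
    proof (rule continuous_le_on_closure[where S = "forward_orbit T y" and f = "\<lambda>z. dist z ((T ^^ (k * i)) z)"])
      show "continuous_on (closure (forward_orbit T y)) (\<lambda>z. dist z ((T ^^ (k * i)) z))"
        using continuous_on_funpow_system[OF dynY] unfolding Y_def
        by (intro continuous_on_dist continuous_on_id)
      show "dist u ((T ^^ (k * i)) u) \<le> e" if "u \<in> forward_orbit T y" for u
      proof -
        obtain a where "u = (T ^^ a) y" using \<open>u \<in> forward_orbit T y\<close> by (auto simp: forward_orbit_def)
        then show ?thesis using k(2)[of a i] by (metis add.commute comp_apply funpow_add)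
      qed
    qed (use z in \<open>simp add: Y_def\<close>)
    then show ?thesis using k(1) by blast
  qed
  have "equicontinuous_system Y T"
    unfolding equicontinuous_system_def
  proof (intro conjI allI impI dynY)
    fix e :: real assume "e > 0"
    then have e3: "e / 3 > 0" by simp
    obtain k where k: "k \<ge> 1" "\<And>z i. z \<in> Y \<Longrightarrow> dist z ((T ^^ (k * i)) z) \<le> e / 3"
      using perY[OF e3] by blast
    obtain d where d: "d > 0" "\<And>r u v. r < k \<Longrightarrow> u \<in> Y \<Longrightarrow> v \<in> Y \<Longrightarrow> dist u v < d
        \<Longrightarrow> dist ((T ^^ r) u) ((T ^^ r) v) < e / 3"
      using funpow_uniformly_continuous_below[OF dynY e3, of k] by blast
    have "dist ((T ^^ n) u) ((T ^^ n) v) < e" if uv: "u \<in> Y" "v \<in> Y" "dist u v < d" for u v n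
    proof -
      define r where "r = n mod k"
      have n: "n = k * (n div k) + r" and r: "r < k"
        using k(1) by (auto simp: r_def)
      \<comment> \<open>The bound is applied at the point \<open>(T ^^ r) w\<close> of
        \<open>Y\<close>, from which time \<open>n\<close> is a multiple of \<open>k\<close>
        away.\<close>
      have near: "dist ((T ^^ r) w) ((T ^^ n) w) \<le> e / 3" if "w \<in> Y" for w
        using k(2)[OF funpow_in_system[OF dynY that], of r "n div k"]
        by (subst n) (simp add: funpow_add)
      show ?thesis
        using near[OF uv(1)] near[OF uv(2)] d(2)[OF r uv]
          dist_triangle[of "(T ^^ n) u" "(T ^^ n) v" "(T ^^ r) u"]
          dist_triangle[of "(T ^^ r) u" "(T ^^ n) v" "(T ^^ r) v"]
        by (simp add: dist_commute)
    qed
    then show "\<exists>d>0. \<forall>u\<in>Y. \<forall>v\<in>Y. dist u v < d \<longrightarrow> (\<forall>n. dist ((T ^^ n) u) ((T ^^ n) v) < e)"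
      using d(1) by blast
  qed
  moreover have "regularly_recurrent Y T y"
    unfolding regularly_recurrent_def
  proof (intro conjI allI impI yY)
    fix U assume U: "openin (top_of_set Y) U \<and> y \<in> U"
    then obtain e where e: "e > 0" "\<And>z. z \<in> Y \<Longrightarrow> dist z y < e \<Longrightarrow> z \<in> U"
      unfolding openin_euclidean_subtopology_iff by blast
    \<comment> \<open>Halving turns the weak bound of \<open>perY\<close> into the strict one that
      \<open>e(2)\<close> asks for.\<close>
    from e(1) have "e / 2 > 0" by simp
    then obtain k where k: "k \<ge> 1" "\<And>z i. z \<in> Y \<Longrightarrow> dist z ((T ^^ (k * i)) z) \<le> e / 2"
      using perY by blast
    have "(T ^^ (k * n)) y \<in> U" for n
      using k(2)[OF yY, of n] e(1) by (intro e(2) funpow_in_system[OF dynY yY]) (simp add: dist_commute)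
    then show "\<exists>k\<ge>1. \<forall>n. (T ^^ (k * n)) y \<in> U" using k(1) by blast
  qed
  ultimately show ?thesis
    using y unfolding odometer_points_def odometer_def Y_def by blast
qed

text \<open>The definition of an odometer provides a regularly recurrent point \<open>x\<close> that
  may differ from \<open>y\<close>. The orbit of \<open>x\<close> is dense in \<open>Y\<close>, so
  it enters any neighbourhood of \<open>y\<close>, and recurrence of \<open>x\<close> brings it back
  there.\<close>

lemma odometer_points_nonwandering:
  assumes dyn: "dynamical_system X T"
  shows "odometer_points X T \<subseteq> nonwandering_set X T"
proof
  fix y assume "y \<in> odometer_points X T"
  define Y where "Y = closure (forward_orbit T y)"
  have y: "y \<in> X" and "odometer Y T"
    using \<open>y \<in> _\<close> by (auto simp: odometer_points_def Y_def)
  then obtain x where x: "regularly_recurrent Y T x" "Y \<subseteq> closure (forward_orbit T x)"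
    by (auto simp: odometer_def)
  have dynY: "dynamical_system Y T" and YX: "Y \<subseteq> X"
    unfolding Y_def using dynamical_system_orbit_closure[OF dyn y] forward_orbit_subset_system[OF dyn y] .
  have xY: "x \<in> Y" using x(1) by (simp add: regularly_recurrent_def)
  have "(T ^^ 0) y \<in> forward_orbit T y"
    unfolding forward_orbit_def by (rule rangeI)
  then have yY: "y \<in> Y"
    using closure_subset unfolding Y_def by auto
  show "y \<in> nonwandering_set X T"
    unfolding nonwandering_set_def
  proof (intro CollectI conjI allI impI y)
    fix U assume "U \<subseteq> X" and "y \<in> (top_of_set X) interior_of U"
    then obtain W where W: "open W" "y \<in> W" "X \<inter> W \<subseteq> U"
      by (auto simp: interior_of_def openin_open)
    have "y \<in> closure (forward_orbit T x)" using x(2) yY by blast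
    then obtain a where a: "(T ^^ a) x \<in> W"
      using W(1,2) unfolding forward_orbit_def closure_iff_nhds_not_empty by blast
    \<comment> \<open>Recurrence is available at \<open>x\<close>, not at \<open>(T ^^ a) x\<close>,
      so the neighbourhood \<open>W\<close> is pulled back along \<open>T ^^ a\<close>.\<close>
    have "openin (top_of_set Y) (Y \<inter> (T ^^ a) -` W)"
      using continuous_on_funpow_system[OF dynY] W(1) by (rule continuous_openin_preimage_gen)
    moreover have "x \<in> Y \<inter> (T ^^ a) -` W" using xY a by simp
    ultimately obtain k where k: "k \<ge> 1" "\<And>n. (T ^^ (k * n)) x \<in> Y \<inter> (T ^^ a) -` W"
      using x(1) unfolding regularly_recurrent_def by meson
    have inU: "(T ^^ n) x \<in> U" if "(T ^^ n) x \<in> W" for n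
      using that W(3) YX funpow_in_system[OF dynY xY] by blast
    have "(T ^^ (a + k)) x \<in> W" using k(2)[of 1] by (simp add: funpow_add)
    then have "(T ^^ k) ((T ^^ a) x) \<in> U" 
      using inU[of "a + k"] by (simp add: funpow_add add.commute[of a])
    then show "\<exists>k\<ge>1. \<exists>y\<in>U. (T ^^ k) y \<in> U" using k(1) inU[OF a] by blast
  qed
qed

section \<open>Periodic pseudo-orbits and their refinement\<close>

text \<open>Repeating the first \<open>k\<close> points of the orbit of \<open>u\<close> gives a
  pseudo-orbit whose only error is the jump from \<open>(T ^^ k) u\<close> back to \<open>u\<close>.
  The tracing point \<open>z\<close> need not be periodic.\<close>

lemma shadowing_periodic:
  assumes dyn: "dynamical_system X T" and sh: "shadowing_property X T" and "e > 0"
  shows "\<exists>d>0. \<forall>u\<in>X. \<forall>k\<ge>1. dist ((T ^^ k) u) u < d \<longrightarrow>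
    (\<exists>z\<in>X. \<forall>a. dist ((T ^^ a) z) ((T ^^ (a mod k)) u) < e)"
proof -
  obtain d where d: "d > 0" "\<And>x. pseudo_orbit X T d x \<Longrightarrow> \<exists>z\<in>X. traced_by T e x z"
    using sh \<open>e > 0\<close> unfolding shadowing_property_def by blast
  have "pseudo_orbit X T d (\<lambda>a. (T ^^ (a mod k)) u)"
    if "u \<in> X" "k \<ge> 1" "dist ((T ^^ k) u) u < d" for u k
    unfolding pseudo_orbit_def
  proof (intro conjI allI)
    fix n
    show "(T ^^ (n mod k)) u \<in> X" by (rule funpow_in_system[OF dyn \<open>u \<in> X\<close>])
    have step: "T ((T ^^ (n mod k)) u) = (T ^^ Suc (n mod k)) u" by simp
    show "dist (T ((T ^^ (n mod k)) u)) ((T ^^ (Suc n mod k)) u) < d"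
      unfolding step using that d(1) by (auto simp del: funpow.simps simp: mod_Suc)
  qed
  then show ?thesis using d unfolding traced_by_def by blast
qed

lemma compact_seq_close_pair:
  fixes f :: "nat \<Rightarrow> 'a::metric_space"
  assumes "compact X" "\<And>n. f n \<in> X" "d > 0"
  obtains i j where "i < j" "dist (f i) (f j) < d"
proof -
  obtain r l where r: "strict_mono r" "(f \<circ> r) \<longlonglongrightarrow> l"
    using assms(1,2) unfolding compact_def by meson
  then have "Cauchy (f \<circ> r)" by (simp add: LIMSEQ_imp_Cauchy)
  then obtain N where "\<And>m n. m \<ge> N \<Longrightarrow> n \<ge> N \<Longrightarrow> dist ((f \<circ> r) m) ((f \<circ> r) n) < d"
    using \<open>d > 0\<close> unfolding Cauchy_def by blast
  then have "dist (f (r N)) (f (r (Suc N))) < d" by auto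
  moreover have "r N < r (Suc N)" using r(1) by (simp add: strict_mono_Suc_iff)
  ultimately show ?thesis using that by blast
qed

text \<open>A pair of a sequence and one of its periods, not necessarily the least. It records a
  tracing point instead of a bound on the jumps, because the next refinement starts from that
  point.\<close>

definition traceable_periodic ::
    "'a::metric_space set \<Rightarrow> ('a \<Rightarrow> 'a) \<Rightarrow> real \<Rightarrow> (nat \<Rightarrow> 'a) \<times> nat \<Rightarrow> bool" where
  "traceable_periodic X T e pk \<longleftrightarrow> snd pk \<ge> 1 \<and> (\<forall>a. fst pk (a + snd pk) = fst pk a) \<and>
    (\<exists>z\<in>X. \<forall>a. dist ((T ^^ a) z) (fst pk a) \<le> e)"

text \<open>The orbit of \<open>w\<close> is sampled only at multiples of \<open>k\<close>, so the
  closed-up segment starts and ends at the same phase of \<open>p\<close>. The new accuracy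
  \<open>e'\<close> is arbitrary, while the distance between the two sequences is inherited from the
  old accuracy \<open>e\<close>.\<close>

lemma traceable_periodic_refine:
  assumes dyn: "dynamical_system X T" and sh: "shadowing_property X T"
    and pk: "traceable_periodic X T e pk" and "e' > 0"
  shows "\<exists>qm. traceable_periodic X T e' qm \<and> (\<forall>a. dist (fst qm a) (fst pk a) \<le> e)"
proof -
  obtain p k where [simp]: "pk = (p, k)" by (cases pk)
  obtain w where k: "k \<ge> 1" and per: "\<And>a. p (a + k) = p a" and w: "w \<in> X"
    and tr: "\<And>a. dist ((T ^^ a) w) (p a) \<le> e"
    using pk by (auto simp: traceable_periodic_def)
  obtain d where d: "d > 0" "\<And>u k. u \<in> X \<Longrightarrow> k \<ge> 1 \<Longrightarrow> dist ((T ^^ k) u) u < d \<Longrightarrow>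
      \<exists>z\<in>X. \<forall>a. dist ((T ^^ a) z) ((T ^^ (a mod k)) u) < e'"
    using shadowing_periodic[OF dyn sh \<open>e' > 0\<close>] by blast
  have "compact X" using dyn by (simp add: dynamical_system_def)
  then obtain i j where ij: "i < j" "dist ((T ^^ (k * i)) w) ((T ^^ (k * j)) w) < d"
    using compact_seq_close_pair[of X "\<lambda>i. (T ^^ (k * i)) w" d] funpow_in_system[OF dyn w] d(1)
    by blast
  define u where "u = (T ^^ (k * i)) w"
  define m where "m = k * (j - i)"
  define q where "q = (\<lambda>a. (T ^^ (a mod m)) u)"
  have u: "u \<in> X" unfolding u_def by (rule funpow_in_system[OF dyn w])
  have m: "m \<ge> 1" using k ij(1) by (simp add: m_def)
  have "m + k * i = k * j" using ij(1) by (simp add: m_def diff_mult_distrib2)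
  then have "(T ^^ m) u = (T ^^ (k * j)) w"
    unfolding u_def by (metis comp_apply funpow_add)
  then have "dist ((T ^^ m) u) u < d"
    using ij(2) by (simp add: u_def dist_commute)
  from d(2)[OF u m this] obtain z where z: "z \<in> X" "\<And>a. dist ((T ^^ a) z) (q a) < e'"
    unfolding q_def by blast
  \<comment> \<open>\<open>q a\<close> is the orbit of \<open>w\<close> at time
    \<open>a mod m + k * i\<close>. There \<open>p\<close> takes the value \<open>p a\<close>,
    because \<open>k\<close> divides both \<open>m\<close> and \<open>k * i\<close>.\<close>
  have "dist (q a) (p a) \<le> e" for a
  proof -
    have "q a = (T ^^ (a mod m + k * i)) w" by (simp add: q_def u_def funpow_add)
    moreover have "p (a mod m + k * i) = p a"
    proof -
      have "p (a mod m + k * i) = p (a mod m mod k)"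
        using periodic_add_mult_mod[of p k, OF per] by metis
      also have "a mod m mod k = a mod k" by (simp add: m_def mod_mod_cancel)
      finally show ?thesis using periodic_add_mult_mod(2)[of p k, OF per] by simp
    qed
    ultimately show ?thesis using tr[of "a mod m + k * i"] by simp
  qed
  moreover have "traceable_periodic X T e' (q, m)"
    using m z less_imp_le by (auto simp: traceable_periodic_def q_def)
  ultimately show ?thesis by (intro exI[of _ "(q, m)"]) simp
qed

section \<open>Passage to the limit\<close>

text \<open>Halving the accuracy at each refinement makes the drift a geometric series: from stage
  \<open>n\<close> on the sequences move pointwise by at most \<open>2 * \<epsilon> n\<close>, which
  at stage 0 is the bound \<open>2 * e\<close>.\<close>

lemma odometer_point_near_periodic:
  assumes dyn: "dynamical_system X T" and sh: "shadowing_property X T"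
    and pk: "traceable_periodic X T e pk" and "e > 0"
  shows "\<exists>y\<in>odometer_points X T. dist y (fst pk 0) \<le> 2 * e"
proof -
  define \<epsilon> where "\<epsilon> n = e / 2 ^ n" for n :: nat
  have \<epsilon>: "\<epsilon> n > 0" "2 * \<epsilon> (Suc n) = \<epsilon> n" for n
    using \<open>e > 0\<close> by (auto simp: \<epsilon>_def)
  \<comment> \<open>The clause for \<open>n = 0\<close> pins the start of the chosen sequence to
    \<open>pk\<close>, to which the final distance estimate refers.\<close>
  have "\<exists>f. \<forall>n. (traceable_periodic X T (\<epsilon> n) (f n) \<and> (n = 0 \<longrightarrow> f n = pk)) \<and>
      (\<forall>a. dist (fst (f (Suc n)) a) (fst (f n) a) \<le> \<epsilon> n)"
  proof (rule dependent_nat_choice)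
    show "\<exists>x. traceable_periodic X T (\<epsilon> 0) x \<and> (0 = (0::nat) \<longrightarrow> x = pk)"
      using pk by (intro exI[of _ pk]) (simp add: \<epsilon>_def)
  next
    fix x n assume "traceable_periodic X T (\<epsilon> n) x \<and> (n = 0 \<longrightarrow> x = pk)"
    then show "\<exists>y. (traceable_periodic X T (\<epsilon> (Suc n)) y \<and> (Suc n = 0 \<longrightarrow> y = pk)) \<and>
        (\<forall>a. dist (fst y a) (fst x a) \<le> \<epsilon> n)"
      using traceable_periodic_refine[OF dyn sh _ \<epsilon>(1)] by auto
  qed
  then obtain f where f: "\<And>n. traceable_periodic X T (\<epsilon> n) (f n)" "f 0 = pk"
    "\<And>n a. dist (fst (f (Suc n)) a) (fst (f n) a) \<le> \<epsilon> n"
    by blast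
  \<comment> \<open>The factor 2 makes these sets decreasing, since \<open>2 * \<epsilon> (Suc n) + \<epsilon> n = 2 * \<epsilon> n\<close>.\<close>
  define Z where "Z n = {z \<in> X. \<forall>a. dist ((T ^^ a) z) (fst (f n) a) \<le> 2 * \<epsilon> n}" for n
  have X: "compact X" using dyn by (simp add: dynamical_system_def)
  have "compact (Z n)" for n
  proof -
    have "closed (X \<inter> (\<lambda>z. dist ((T ^^ a) z) (fst (f n) a)) -` {..2 * \<epsilon> n})" for a
      using X continuous_on_funpow_system[OF dyn]
      by (intro continuous_closed_preimage continuous_on_dist continuous_on_const)
        (auto simp: compact_imp_closed)
    then have "closed (\<Inter>a. X \<inter> (\<lambda>z. dist ((T ^^ a) z) (fst (f n) a)) -` {..2 * \<epsilon> n})"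
      by (intro closed_INT ballI)
    moreover have "Z n = X \<inter> (\<Inter>a. X \<inter> (\<lambda>z. dist ((T ^^ a) z) (fst (f n) a)) -` {..2 * \<epsilon> n})"
      by (auto simp: Z_def)
    ultimately show ?thesis by (simp only: compact_Int_closed[OF X])
  qed
  then have clo: "closed (Z n)" for n by (rule compact_imp_closed)
  have ne: "Z n \<noteq> {}" for n
  proof -
    obtain z where "z \<in> X" "\<And>a. dist ((T ^^ a) z) (fst (f n) a) \<le> \<epsilon> n"
      using f(1)[of n] by (auto simp: traceable_periodic_def)
    moreover have "\<epsilon> n \<le> 2 * \<epsilon> n" using \<epsilon>(1)[of n] by simp
    ultimately have "z \<in> Z n" unfolding Z_def using order_trans by blast
    then show ?thesis by blast
  qed
  have step: "Z (Suc n) \<subseteq> Z n" for n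
  proof
    fix z assume z: "z \<in> Z (Suc n)"
    have "dist ((T ^^ a) z) (fst (f n) a) \<le> 2 * \<epsilon> n" for a
    proof -
      have "dist ((T ^^ a) z) (fst (f (Suc n)) a) \<le> \<epsilon> n"
        using z unfolding Z_def \<epsilon>(2) by blast
      then show ?thesis
        using f(3)[of n a] dist_triangle[of "(T ^^ a) z" "fst (f n) a" "fst (f (Suc n)) a"]
        by linarith
    qed
    then show "z \<in> Z n" using z by (auto simp: Z_def)
  qed
  have dec: "Z n \<subseteq> Z m" if "m \<le> n" for m n
    using lift_Suc_antimono_le[of Z, OF step that] .
  have fip: "X \<inter> \<Inter> (Z ` I) \<noteq> {}" if fin: "finite I" for I :: "nat set"
  proof -
    obtain N where "\<And>i. i \<in> I \<Longrightarrow> i \<le> N"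
      using fin by (auto simp: finite_nat_set_iff_bounded_le)
    then have "Z N \<subseteq> \<Inter> (Z ` I)"
      by (intro INT_greatest dec)
    moreover have "Z N \<subseteq> X" unfolding Z_def by (rule Collect_restrict)
    ultimately show ?thesis using ne[of N] by blast
  qed
  have "X \<inter> \<Inter> (range Z) \<noteq> {}"
    by (rule compact_imp_fip_image[OF X clo fip])
  then obtain y where y: "\<And>n. y \<in> Z n" by blast
  have yX: "y \<in> X" using y[of 0] by (simp add: Z_def)
  have "y \<in> odometer_points X T"
  proof (rule odometer_pointI[OF dyn yX])
    fix c :: real assume "c > 0"
    \<comment> \<open>The factor 4 arises because \<open>y\<close> at times \<open>a\<close> and
      \<open>a + k * i\<close>, with \<open>k\<close> the period of \<open>f n\<close>, is within
      \<open>2 * \<epsilon> n\<close> of one and the same value.\<close>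
    then obtain n where "4 * e / c < 2 ^ n" using real_arch_pow[of 2] by auto
    then have n: "4 * \<epsilon> n \<le> c" using \<open>c > 0\<close> by (simp add: \<epsilon>_def field_simps)
    have k: "snd (f n) \<ge> 1" and per: "\<And>a. fst (f n) (a + snd (f n)) = fst (f n) a"
      using f(1)[of n] by (auto simp: traceable_periodic_def)
    have near: "dist ((T ^^ a) y) (fst (f n) a) \<le> 2 * \<epsilon> n" for a
      using y[of n] by (simp add: Z_def)
    have "dist ((T ^^ a) y) ((T ^^ (a + snd (f n) * i)) y) \<le> c" for a i
      using near[of a] near[of "a + snd (f n) * i"] n periodic_add_mult_mod(1)[of "fst (f n)", OF per, of a i]
        dist_triangle2[of "(T ^^ a) y" "(T ^^ (a + snd (f n) * i)) y" "fst (f n) a"]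
      by simp
    then show "\<exists>k\<ge>1. \<forall>a i. dist ((T ^^ a) y) ((T ^^ (a + k * i)) y) \<le> c"
      using k by blast
  qed
  moreover have "dist y (fst pk 0) \<le> 2 * e"
  proof -
    have "dist ((T ^^ 0) y) (fst (f 0) 0) \<le> 2 * \<epsilon> 0"
      using y[of 0] unfolding Z_def by blast
    then show ?thesis using f(2) by (simp add: \<epsilon>_def)
  qed
  ultimately show ?thesis by blast
qed

section \<open>Density in the non-wandering set\<close>

lemma nonwandering_return:
  assumes x: "x \<in> nonwandering_set X T" and "h > 0"
  shows "\<exists>k\<ge>1. \<exists>u\<in>X. dist u x < h \<and> dist ((T ^^ k) u) x < h"
proof -
  let ?U = "X \<inter> ball x h"
  have "x \<in> X" using x by (simp add: nonwandering_set_def)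
  moreover have "openin (top_of_set X) ?U" by (simp add: openin_open_Int)
  ultimately have "x \<in> (top_of_set X) interior_of ?U"
    using \<open>h > 0\<close> by (simp add: interior_of_openin)
  then obtain k u where "k \<ge> 1" "u \<in> ?U" "(T ^^ k) u \<in> ?U"
    using x unfolding nonwandering_set_def by blast
  then show ?thesis
    by (intro exI[of _ k] conjI bexI[of _ u]) (simp_all add: dist_commute)
qed

text \<open>Density is stated as two inclusions, so the odometer points are also shown to lie in the
  set in which they are dense.\<close>

theorem corollary3p3:
  fixes X :: "'a::metric_space set" and T :: "'a \<Rightarrow> 'a"
  assumes "dynamical_system X T"
    and "shadowing_property X T"
  shows "odometer_points X T \<subseteq> nonwandering_set X T
    \<and> nonwandering_set X T \<subseteq> closure (odometer_points X T)"
proof (intro conjI subsetI)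
  show "x \<in> nonwandering_set X T" if "x \<in> odometer_points X T" for x
    using odometer_points_nonwandering[OF assms(1)] that by blast
next
  fix x assume x: "x \<in> nonwandering_set X T"
  show "x \<in> closure (odometer_points X T)"
    unfolding closure_approachable
  proof (intro allI impI)
    fix e :: real assume "e > 0"
    then have e: "e / 3 > 0" by simp
    obtain d where d: "d > 0" "\<And>u k. u \<in> X \<Longrightarrow> k \<ge> 1 \<Longrightarrow> dist ((T ^^ k) u) u < d \<Longrightarrow>
        \<exists>z\<in>X. \<forall>a. dist ((T ^^ a) z) ((T ^^ (a mod k)) u) < e / 3"
      using shadowing_periodic[OF assms e] by blast
    \<comment> \<open>Through \<open>x\<close>, the bound \<open>d / 2\<close> makes
      \<open>u\<close> and its return \<open>d\<close>-close. The bound \<open>e / 3\<close> on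
      \<open>dist u x\<close> is what remains of \<open>e\<close> after the
      \<open>2 * (e / 3)\<close> between \<open>y\<close> and \<open>u\<close>.\<close>
    have "min (d / 2) (e / 3) > 0" using d(1) e by simp
    then obtain k u where k: "k \<ge> 1" and u: "u \<in> X"
      "dist u x < min (d / 2) (e / 3)" "dist ((T ^^ k) u) x < min (d / 2) (e / 3)"
      using nonwandering_return[OF x] by blast
    have "dist ((T ^^ k) u) u < d"
      using u(2,3) dist_triangle2[of "(T ^^ k) u" u x] by simp
    then have "\<exists>z\<in>X. \<forall>a. dist ((T ^^ a) z) ((T ^^ (a mod k)) u) \<le> e / 3"
      using d(2)[OF u(1) k] less_imp_le by metis
    then have "traceable_periodic X T (e / 3) (\<lambda>a. (T ^^ (a mod k)) u, k)"
      using k by (simp add: traceable_periodic_def)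
    from odometer_point_near_periodic[OF assms this e]
    obtain y where "y \<in> odometer_points X T" "dist y u \<le> 2 * (e / 3)" by auto
    moreover have "dist y x < e"
      using calculation(2) u(2) dist_triangle[of y x u] by simp
    ultimately show "\<exists>y\<in>odometer_points X T. dist y x < e" by blast
  qed
qed

end
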